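(* Let $\mathfrak{g}=A_{5,4}$ and let $\langle\cdot,\cdot\rangle$ be an inner product on $\mathfrak{g}$. Let $\eta>0$ and let $\{v_1,\dots,v_5\}$ be a basis of $\mathfrak{g}$, orthonormal with respect to $\eta\langle\cdot,\cdot\rangle$, whose only nonzero brackets (up to antisymmetry) are $[v_1,v_3]=\alpha v_5$, $[v_1,v_4]=\beta v_5$, $[v_2,v_3]=\gamma v_5$, with $\beta,\gamma>0$ and $\alpha\in\mathbb{R}$. Then $\langle\cdot,\cdot\rangle$ is a nilsoliton if and only if $\alpha=0$ and $\beta=\gamma$.
   Context: $A_{5,4}$ is the five-dimensional real nilpotent Lie algebra having a basis with the brackets displayed in the claim. An inner product on $\mathfrak{g}$ is identified with the left-invariant Riemannian metric $g$ it induces on the simply connected Lie group $G$ with Lie algebra $\mathfrak{g}$. Let $ric_g$ be the Ricci curvature tensor of $(G,g)$ (Levi-Civita connection), viewed as a symmetric bilinear form on $\mathfrak{g}$; since $\mathfrak{g}$ is nilpotent, $ric_g(u,v)=-\frac12\mathrm{tr}(ad_u\circ ad_v^* )-\frac14\mathrm{tr}(J_u\circ J_v)$, where $ad_uv=[u,v]$, $ad_v^*$ is the $g$-transpose of $ad_v$, and $J_uv=ad_v^*u$. The Ricci operator $Ric_g$ is defined by $ric_g(u,v)=g(Ric_g(u),v)$. The metric $g$ is a nilsoliton if $Ric_g\in\mathbb{R}\,\mathrm{Id}_{\mathfrak{g}}\oplus Der(\mathfrak{g})$, i.e. $Ric_g=c\,\mathrm{Id}+D$ for some $c\in\mathbb{R}$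 and some derivation $D$ of $\mathfrak{g}$. *)

theory Defs
  imports "HOL-Analysis.Analysis"
begin

definition is_lie_bracket :: "('a::real_vector \<Rightarrow> 'a \<Rightarrow> 'a) \<Rightarrow> bool" where
  "is_lie_bracket br \<longleftrightarrow> bilinear br \<and> (\<forall>x. br x x = 0) \<and>
     (\<forall>x y z. br x (br y z) + br y (br z x) + br z (br x y) = 0)"

definition derivation :: "('a::real_vector \<Rightarrow> 'a \<Rightarrow> 'a) \<Rightarrow> ('a \<Rightarrow> 'a) \<Rightarrow> bool" where
  "derivation br D \<longleftrightarrow> linear D \<and> (\<forall>x y. D (br x y) = br (D x) y + br x (D y))"

definition is_inner_product :: "('a::real_vector \<Rightarrow> 'a \<Rightarrow> real) \<Rightarrow> bool" where
  "is_inner_product g \<longleftrightarrow> bilinear g \<and> (\<forall>x y. g x y = g y x) \<and> (\<forall>x. x \<noteq> 0 \<longrightarrow> g x x > 0)"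

definition is_basis5 :: "(nat \<Rightarrow> 'a::real_vector) \<Rightarrow> bool" where
  "is_basis5 v \<longleftrightarrow> inj_on v {1..5} \<and> independent (v ` {1..5}) \<and> span (v ` {1..5}) = UNIV"

definition orthonormal5 :: "('a \<Rightarrow> 'a \<Rightarrow> real) \<Rightarrow> (nat \<Rightarrow> 'a) \<Rightarrow> bool" where
  "orthonormal5 g v \<longleftrightarrow> (\<forall>i\<in>{1..5}. \<forall>j\<in>{1..5}. g (v i) (v j) = (if i = j then 1 else 0))"

definition has_brackets ::
  "('a::real_vector \<Rightarrow> 'a \<Rightarrow> 'a) \<Rightarrow> (nat \<Rightarrow> 'a) \<Rightarrow> real \<Rightarrow> real \<Rightarrow> real \<Rightarrow> bool" where
  "has_brackets br v \<alpha> \<beta> \<gamma> \<longleftrightarrow> (\<forall>i\<in>{1..5}. \<forall>j\<in>{1..5}. i < j \<longrightarrow>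
     br (v i) (v j) =
       (if (i, j) = (1, 3) then \<alpha> *\<^sub>R v 5
        else if (i, j) = (1, 4) then \<beta> *\<^sub>R v 5
        else if (i, j) = (2, 3) then \<gamma> *\<^sub>R v 5
        else 0))"

text \<open>Normal form of the algebra. By \<open>is_A54I\<close> below, every bracket table with
  \<open>\<beta>, \<gamma> > 0\<close> and arbitrary \<open>\<alpha>\<close> defines the same algebra up to isomorphism.\<close>

definition is_A54 :: "('a::real_vector \<Rightarrow> 'a \<Rightarrow> 'a) \<Rightarrow> bool" where
  "is_A54 br \<longleftrightarrow> is_lie_bracket br \<and> (\<exists>e. is_basis5 e \<and> has_brackets br e 0 1 1)"

text \<open>Trace of an endomorphism of a finite-dimensional space (the choice of basis is immaterial).\<close>

definition lin_trace :: "('a::real_vector \<Rightarrow> 'a) \<Rightarrow> real" where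
  "lin_trace f = (let B = (SOME B. independent B \<and> span B = UNIV)
                  in \<Sum>b\<in>B. representation B (f b) b)"

text \<open>Left-invariant objects on the simply connected group are identified with their values on the
  Lie algebra. For left-invariant \<open>u\<close>, \<open>v\<close> the covariant derivative of \<open>v\<close> along \<open>u\<close> is
  left-invariant and \<open>g u v\<close> is a constant function, so compatibility with the metric
  has no derivative term.\<close>

definition is_levi_civita ::
  "('a::real_vector \<Rightarrow> 'a \<Rightarrow> 'a) \<Rightarrow> ('a \<Rightarrow> 'a \<Rightarrow> real) \<Rightarrow> ('a \<Rightarrow> 'a \<Rightarrow> 'a) \<Rightarrow> bool" where
  "is_levi_civita br g N \<longleftrightarrow> bilinear N \<and>
     (\<forall>u v. N u v - N v u = br u v) \<and>
     (\<forall>u v w. g (N u v) w + g v (N u w) = 0)"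

definition levi_civita ::
  "('a::real_vector \<Rightarrow> 'a \<Rightarrow> 'a) \<Rightarrow> ('a \<Rightarrow> 'a \<Rightarrow> real) \<Rightarrow> 'a \<Rightarrow> 'a \<Rightarrow> 'a" where
  "levi_civita br g = (THE N. is_levi_civita br g N)"

definition curvature ::
  "('a::real_vector \<Rightarrow> 'a \<Rightarrow> 'a) \<Rightarrow> ('a \<Rightarrow> 'a \<Rightarrow> real) \<Rightarrow> 'a \<Rightarrow> 'a \<Rightarrow> 'a \<Rightarrow> 'a" where
  "curvature br g u v w =
     (let N = levi_civita br g in N u (N v w) - N v (N u w) - N (br u v) w)"

definition ric ::
  "('a::real_vector \<Rightarrow> 'a \<Rightarrow> 'a) \<Rightarrow> ('a \<Rightarrow> 'a \<Rightarrow> real) \<Rightarrow> 'a \<Rightarrow> 'a \<Rightarrow> real" where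
  "ric br g u v = lin_trace (\<lambda>w. curvature br g w u v)"

definition Ric ::
  "('a::real_vector \<Rightarrow> 'a \<Rightarrow> 'a) \<Rightarrow> ('a \<Rightarrow> 'a \<Rightarrow> real) \<Rightarrow> 'a \<Rightarrow> 'a" where
  "Ric br g u = (THE x. \<forall>v. g x v = ric br g u v)"

definition nilsoliton ::
  "('a::real_vector \<Rightarrow> 'a \<Rightarrow> 'a) \<Rightarrow> ('a \<Rightarrow> 'a \<Rightarrow> real) \<Rightarrow> bool" where
  "nilsoliton br g \<longleftrightarrow> (\<exists>c D. derivation br D \<and> (\<forall>u. Ric br g u = c *\<^sub>R u + D u))"

lemma levi_civita_koszul:
  assumes "is_inner_product g" and "is_levi_civita br g N"
  shows "2 * g (N u v) w = g (br u v) w + g (br w u) v - g (br v w) u"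
proof -
  have b: "bilinear g" and s: "\<And>x y. g x y = g y x"
    using assms(1) by (auto simp: is_inner_product_def)
  have c: "g (N x y) z = - g (N x z) y" for x y z
    using assms(2) s[of y "N x z"] unfolding is_levi_civita_def
    by (metis add_eq_0_iff2)
  have t: "g (br x y) z = g (N x y) z - g (N y x) z" for x y z
    using assms(2) by (metis b bilinear_lsub is_levi_civita_def)
  show ?thesis
    using t[of u v w] t[of w u v] t[of v w u] c[of u v w] c[of v u w] c[of w u v] by linarith
qed

lemma levi_civita_unique:
  assumes "is_inner_product g" "is_levi_civita br g N" "is_levi_civita br g N'"
  shows "N = N'"
proof (intro ext)
  fix u v
  have b: "bilinear g" and pos: "\<And>x. x \<noteq> 0 \<Longrightarrow> g x x > 0"
    using assms(1) by (auto simp: is_inner_product_def)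
  let ?d = "N u v - N' u v"
  have "g ?d ?d = g (N u v) ?d - g (N' u v) ?d"
    by (rule bilinear_lsub[OF b])
  also have "\<dots> = 0"
    using levi_civita_koszul[OF assms(1,2), of u v ?d]
      levi_civita_koszul[OF assms(1,3), of u v ?d] by linarith
  finally show "N u v = N' u v"
    using pos[of ?d] by force
qed

lemma is_A54I:
  fixes br :: "'a::real_vector \<Rightarrow> 'a \<Rightarrow> 'a"
  assumes lie: "is_lie_bracket br" and bas: "is_basis5 v" and hb: "has_brackets br v \<alpha> \<beta> \<gamma>"
    and pos: "\<beta> > 0" "\<gamma> > 0"
  shows "is_A54 br"
proof -
  have bil: "bilinear br" and alt: "\<And>x. br x x = 0"
    using lie by (auto simp: is_lie_bracket_def)
  have I5: "{1..5::nat} = {1, 2, 3, 4, 5}" by auto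
  have br: "br (v 1) (v 2) = 0" "br (v 1) (v 3) = \<alpha> *\<^sub>R v 5" "br (v 1) (v 4) = \<beta> *\<^sub>R v 5"
    "br (v 1) (v 5) = 0" "br (v 2) (v 3) = \<gamma> *\<^sub>R v 5" "br (v 2) (v 4) = 0" "br (v 2) (v 5) = 0"
    "br (v 3) (v 4) = 0" "br (v 3) (v 5) = 0" "br (v 4) (v 5) = 0"
    using hb unfolding has_brackets_def I5 by simp_all
  have br44: "br (v 4) (v 4) = 0" by (rule alt)
  define e :: "nat \<Rightarrow> 'a" where "e i =
    (if i = 1 then (1 / \<beta>) *\<^sub>R v 1 else if i = 2 then (1 / \<gamma>) *\<^sub>R v 2
     else if i = 3 then v 3 - (\<alpha> / \<beta>) *\<^sub>R v 4 else v i)" for i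
  have e: "e 1 = (1 / \<beta>) *\<^sub>R v 1" "e 2 = (1 / \<gamma>) *\<^sub>R v 2"
    "e 3 = v 3 - (\<alpha> / \<beta>) *\<^sub>R v 4" "e 4 = v 4" "e 5 = v 5"
    by (simp_all add: e_def)
  note bs = bilinear_lmul[OF bil] bilinear_rmul[OF bil] bilinear_lsub[OF bil] bilinear_rsub[OF bil]
  have heb: "has_brackets br e 0 1 1"
    unfolding has_brackets_def I5 using pos by (simp add: e[simplified] bs br[simplified] br44)
  let ?V = "v ` {1..5}" and ?E = "e ` {1..5}"
  have inV: "v i \<in> span ?E" if "i \<in> {1..5}" for i
  proof -
    have m: "e j \<in> span ?E" if "j \<in> {1..5}" for j
      using that by (intro span_base imageI)
    have "v 1 = \<beta> *\<^sub>R e 1" "v 2 = \<gamma> *\<^sub>R e 2" "v 3 = e 3 + (\<alpha> / \<beta>) *\<^sub>R e 4" "v 4 = e 4" "v 5 = e 5"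
      using pos by (simp_all add: e[simplified])
    moreover have "\<beta> *\<^sub>R e 1 \<in> span ?E" "\<gamma> *\<^sub>R e 2 \<in> span ?E"
      "e 3 + (\<alpha> / \<beta>) *\<^sub>R e 4 \<in> span ?E" "e 4 \<in> span ?E" "e 5 \<in> span ?E"
      by (intro span_add span_scale m; simp)+
    ultimately have "v 1 \<in> span ?E" "v 2 \<in> span ?E" "v 3 \<in> span ?E" "v 4 \<in> span ?E" "v 5 \<in> span ?E"
      by metis+
    then show ?thesis using that unfolding I5 by blast
  qed
  have "span ?V \<subseteq> span ?E"
    using inV by (intro span_minimal) auto
  then have sp: "span ?E = UNIV"
    using bas by (auto simp: is_basis5_def)
  have cV: "card ?V = 5"
    using bas by (simp add: is_basis5_def card_image)
  have "5 \<le> card ?E"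
    using independent_span_bound[of ?E ?V] bas sp cV by (auto simp: is_basis5_def)
  moreover have "card ?E \<le> 5"
    using card_image_le[of "{1..5::nat}" e] by simp
  ultimately have cE: "card ?E = 5" by simp
  have inj: "inj_on e {1..5}"
    by (rule eq_card_imp_inj_on) (use cE in auto)
  have d: "dim ?E = 5"
    using bas sp cV by (metis dim_eq_card_independent dim_span is_basis5_def)
  obtain B where B: "B \<subseteq> ?E" "independent B" "?E \<subseteq> span B" "card B = dim ?E"
    using basis_exists[of ?E] by blast
  then have "B = ?E"
    using cE d by (intro card_subset_eq) auto
  with B have "independent ?E" by simp
  with inj sp heb lie show ?thesis
    unfolding is_A54_def is_basis5_def by blast
qed

end

theory Submission
  imports Defs
begin

text \<open>Write \<open>h = \<eta> ip\<close> and \<open>z = v 5\<close>. The bracket is \<open>[u, w] = h (J u) w z\<close> for a skew map \<open>J\<close>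
  killing \<open>z\<close>, and such an algebra has the Levi-Civita connection
  \<open>2 N u w = h (J u) w z - h w z J u - h u z J w\<close>, whence the Ricci operator of \<open>h\<close> is
  \<open>1/4 |J|^2 h u z z + 1/2 J (J u)\<close>; the one of \<open>ip\<close> is \<open>\<eta>\<close> times this.
  Thus \<open>ip\<close> is a nilsoliton iff some \<open>D = Ric - c\<close> is a derivation. The Leibniz rule for
  \<open>[v 2, v 4] = 0\<close> reads \<open>\<alpha> \<beta> \<gamma> = 0\<close>, and for \<open>\<alpha> = 0\<close> the rules for \<open>[v 1, v 4]\<close> and
  \<open>[v 2, v 3]\<close> give \<open>\<beta>^2 = \<gamma>^2\<close>. Conversely, if \<open>\<alpha> = 0\<close> and \<open>\<beta> = \<gamma>\<close> then
  \<open>J (J u) = - \<beta>^2 (u - h u z z)\<close> and \<open>c = - 2 \<eta> \<beta>^2\<close> works.\<close>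

section \<open>Connection and Ricci curvature under rescaling of the metric\<close>

lemma levi_civita_eqI:
  assumes "is_inner_product g" "is_levi_civita br g N"
  shows "levi_civita br g = N"
  unfolding levi_civita_def
  using assms levi_civita_unique by (blast intro: the_equality)

text \<open>The torsion condition does not involve the metric, and compatibility is homogeneous in
  it.\<close>

lemma is_levi_civita_scale:
  assumes "c \<noteq> 0"
  shows "is_levi_civita br (\<lambda>x y. c * g x y) N \<longleftrightarrow> is_levi_civita br g N"
  using assms unfolding is_levi_civita_def by (simp flip: distrib_left)

lemma ric_scale:
  assumes "c \<noteq> 0"
  shows "ric br (\<lambda>x y. c * g x y) = ric br g"
  using assms by (simp add: fun_eq_iff ric_def curvature_def levi_civita_def is_levi_civita_scale)

lemma Ric_eqI:
  assumes "is_inner_product g" "\<And>w. g x w = ric br g u w"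
  shows "Ric br g u = x"
  unfolding Ric_def
proof (rule the_equality)
  have b: "bilinear g" and pos: "\<And>x. x \<noteq> 0 \<Longrightarrow> g x x > 0"
    using assms(1) by (auto simp: is_inner_product_def)
  fix y assume y: "\<forall>w. g y w = ric br g u w"
  then have "g (y - x) (y - x) = 0"
    by (simp add: bilinear_lsub[OF b] assms(2))
  then show "y = x"
    using pos[of "y - x"] by force
qed (use assms in simp)

section \<open>Expansions and traces in an orthonormal frame\<close>

locale orthonormal_frame =
  fixes h :: "'a::real_vector \<Rightarrow> 'a \<Rightarrow> real" and E :: "'a set"
  assumes inner: "is_inner_product h"
    and fin: "finite E" and span_E: "span E = UNIV"
    and orth: "\<And>a b. a \<in> E \<Longrightarrow> b \<in> E \<Longrightarrow> h a b = (if a = b then 1 else 0)"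
begin

lemma bil: "bilinear h" and sym: "h x y = h y x"
  using inner by (auto simp: is_inner_product_def)

lemmas h_simps = bilinear_ladd[OF bil] bilinear_radd[OF bil] bilinear_lsub[OF bil]
  bilinear_rsub[OF bil] bilinear_lmul[OF bil] bilinear_rmul[OF bil] bilinear_lzero[OF bil]
  bilinear_rzero[OF bil] bilinear_lneg[OF bil] bilinear_rneg[OF bil]

lemma linear_left: "linear (\<lambda>x. h x y)"
  using bil by (auto simp: bilinear_def)

lemma expand: "x = (\<Sum>e\<in>E. h x e *\<^sub>R e)"
proof (rule linear_eq_on[where f = "\<lambda>x. x"])
  show "linear (\<lambda>x. x)" by (rule linear_ident)
  show "linear (\<lambda>x. \<Sum>e\<in>E. h x e *\<^sub>R e)"
    by (rule linearI) (simp_all add: h_simps scaleR_add_left sum.distrib scaleR_sum_right)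
  show "x \<in> span E" by (simp add: span_E)
  show "b = (\<Sum>e\<in>E. h b e *\<^sub>R e)" if "b \<in> E" for b
    using that by (simp add: orth if_distrib[of "\<lambda>c. c *\<^sub>R _"] fin cong: if_cong)
qed

lemma linear_expand:
  assumes "linear f"
  shows "f x = (\<Sum>e\<in>E. h x e *\<^sub>R f e)"
proof -
  have "f x = f (\<Sum>e\<in>E. h x e *\<^sub>R e)" using expand[of x] by simp
  then show ?thesis
    by (simp add: linear_sum[OF assms] linear_scale[OF assms])
qed

lemma parseval: "(\<Sum>e\<in>E. h x e * h y e) = h x y"
  using linear_expand[OF linear_left, of x y] by (simp add: sym)

text \<open>\<open>lin_trace\<close> sums over a basis fixed by choice; expanding its vectors in the
  frame and swapping the two sums moves the trace to \<open>E\<close>.\<close>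

lemma lin_trace_eq:
  assumes f: "linear f"
  shows "lin_trace f = (\<Sum>e\<in>E. h (f e) e)"
proof -
  define B :: "'a set" where "B = (SOME B. independent B \<and> span B = UNIV)"
  have "\<exists>B::'a set. independent B \<and> span B = UNIV"
    by (metis maximal_independent_subset span_UNIV span_mono span_superset subset_antisym span_span
        top_greatest)
  then have B: "independent B" "span B = UNIV"
    unfolding B_def by (metis (mono_tags, lifting) someI_ex)+
  have finB: "finite B"
    using independent_span_bound[OF fin B(1)] span_E by simp
  have rep: "representation B (f b) b' = (\<Sum>e\<in>E. h b e * representation B (f e) b')" for b b'
    by (subst linear_expand[OF f])
      (simp add: representation_sum[OF B(1)] representation_scale[OF B(1)] B(2))
  have "lin_trace f = (\<Sum>b\<in>B. \<Sum>e\<in>E. h b e * representation B (f e) b)"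
    unfolding lin_trace_def B_def[symmetric] by (simp add: rep[of b b for b])
  also have "\<dots> = (\<Sum>e\<in>E. h (\<Sum>b\<in>B. representation B (f e) b *\<^sub>R b) e)"
    by (subst sum.swap)
      (simp add: linear_sum[OF linear_left] linear_scale[OF linear_left] mult.commute)
  also have "\<dots> = (\<Sum>e\<in>E. h (f e) e)"
    by (simp add: sum_representation_eq[OF B(1) _ finB] B(2))
  finally show ?thesis .
qed

end

section \<open>Ricci curvature when all brackets lie on one central line\<close>

text \<open>\<open>J x\<close> is the transpose of \<open>br x\<close> applied to the unit vector
  \<open>z\<close>; \<open>Jz\<close> makes \<open>z\<close> central.\<close>

locale heisenberg_type = orthonormal_frame h E
  for h :: "'a::real_vector \<Rightarrow> 'a \<Rightarrow> real" and E +
  fixes br :: "'a \<Rightarrow> 'a \<Rightarrow> 'a" and J :: "'a \<Rightarrow> 'a" and z :: 'a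
  assumes J: "linear J" and skew: "h (J x) y = - h x (J y)"
    and Jz: "J z = 0" and zz: "h z z = 1"
    and br: "br x y = h (J x) y *\<^sub>R z"
begin

lemmas J_simps = linear_add[OF J] linear_diff[OF J] linear_scale[OF J] linear_neg[OF J]
  linear_0[OF J] Jz

lemma hJz: "h (J x) z = 0" "h z (J x) = 0"
  using skew[of x z] sym[of z "J x"] by (simp_all add: Jz h_simps)

lemma hJ_self: "h (J x) x = 0"
  using skew[of x x] sym[of x "J x"] by simp

text \<open>Read off from \<open>levi_civita_koszul\<close>, with skewness used to move
  \<open>J\<close> off the third argument.\<close>

definition N where
  "N u w = (1/2) *\<^sub>R (h (J u) w *\<^sub>R z - h w z *\<^sub>R J u - h u z *\<^sub>R J w)"

lemma N_bilinear: "bilinear N"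
  unfolding bilinear_def N_def
  by (auto intro!: linearI simp: h_simps J_simps scaleR_add_left scaleR_diff_left algebra_simps
      add_divide_distrib)

lemma is_levi_civita_N: "is_levi_civita br h N"
  unfolding is_levi_civita_def
proof (intro conjI allI)
  fix u w x
  show "N u w - N w u = br u w"
    using skew[of w u] sym[of w "J u"]
    by (simp add: N_def br algebra_simps flip: scaleR_add_left)
  show "h (N u w) x + h w (N u x) = 0"
    using skew[of w x] sym[of w z] sym[of x z] sym[of w "J u"]
    by (simp add: N_def h_simps algebra_simps)
qed (rule N_bilinear)

lemma curvature_eq:
  "curvature br h u v w = N u (N v w) - N v (N u w) - N (br u v) w"
  by (simp add: curvature_def levi_civita_eqI[OF inner is_levi_civita_N] Let_def)

lemma N_z_left: "N z w = - (1/2) *\<^sub>R J w"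
  by (simp add: N_def Jz h_simps zz)

text \<open>The trace splits along the three curvature terms. In each, \<open>parseval\<close>
  collapses the products of frame coefficients, and images of \<open>J\<close> pair to zero with
  \<open>z\<close>; only the squared norm of \<open>J\<close> remains as a sum.\<close>

lemma ric_eq:
  "ric br h u w = 1/4 * (\<Sum>e\<in>E. h (J e) (J e)) * h u z * h w z - 1/2 * h (J u) (J w)"
proof -
  note Nb = bilinear_ladd[OF N_bilinear] bilinear_radd[OF N_bilinear]
    bilinear_lmul[OF N_bilinear] bilinear_rmul[OF N_bilinear] bilinear_lneg[OF N_bilinear]
  have "linear (\<lambda>e. curvature br h e u w)"
    by (rule linearI)
      (simp_all add: curvature_eq br Nb h_simps J_simps algebra_simps)
  then have "ric br h u w = (\<Sum>e\<in>E. h (curvature br h e u w) e)"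
    unfolding ric_def by (rule lin_trace_eq)
  also have "\<dots> = (\<Sum>e\<in>E. h (N e (N u w)) e) - (\<Sum>e\<in>E. h (N u (N e w)) e)
      - (\<Sum>e\<in>E. h (N (br e u) w) e)"
    by (simp add: curvature_eq h_simps sum_subtractf)
  also have "(\<Sum>e\<in>E. h (N e m) e) = 0" for m
  proof -
    have "h (N e m) e = 1/2 * (- (h (J m) e * h z e) - h (J m) e * h z e)" for e
      using skew[of e m] sym[of e "J m"] sym[of e z]
      by (simp add: N_def h_simps hJ_self)
    then show ?thesis
      by (simp add: parseval hJz flip: sum_distrib_left sum_divide_distrib
          add: sum_subtractf sum_negf)
  qed
  \<comment> \<open>The contributions \<open>h (J w) (J u)\<close> and
    \<open>h (J u) (J w) * h z z\<close> cancel, since \<open>z\<close> has length one.\<close>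
  also have "(\<Sum>e\<in>E. h (N u (N e w)) e) = - 1/4 * (\<Sum>e\<in>E. h (J e) (J e)) * h u z * h w z"
  proof -
    have "h (N u (N e w)) e = 1/4 * (h (J w) e * h (J u) e + h w z * (h (J (J u)) e * h z e)
        - h w z * h u z * h (J e) (J e) - h (J u) (J w) * (h z e * h z e)
        + h u z * (h (J (J w)) e * h z e))" for e
      using skew[of e w] skew[of "J e" e] skew[of "J u" e] sym[of e "J w"] sym[of e z]
      by (simp add: N_def h_simps J_simps hJz zz field_simps)
    then have "(\<Sum>e\<in>E. h (N u (N e w)) e) = (\<Sum>e\<in>E. 1/4 * (h (J w) e * h (J u) e
        + h w z * (h (J (J u)) e * h z e) - h w z * h u z * h (J e) (J e)
        - h (J u) (J w) * (h z e * h z e) + h u z * (h (J (J w)) e * h z e)))"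
      by (intro sum.cong refl)
    also have "\<dots> = 1/4 * (h (J w) (J u) + h w z * h (J (J u)) z
        - h w z * h u z * (\<Sum>e\<in>E. h (J e) (J e)) - h (J u) (J w) * h z z
        + h u z * h (J (J w)) z)"
      by (simp only: sum_distrib_left[symmetric] sum.distrib sum_subtractf parseval)
    finally show ?thesis
      by (simp add: hJz zz sym[of "J w" "J u"])
  qed
  also have "(\<Sum>e\<in>E. h (N (br e u) w) e) = 1/2 * h (J u) (J w)"
  proof -
    have "h (N (br e u) w) e = 1/2 * (h (J u) e * h (J w) e)" for e
      using skew[of e u] sym[of e "J u"]
      by (simp add: br Nb N_z_left h_simps)
    then have "(\<Sum>e\<in>E. h (N (br e u) w) e) = (\<Sum>e\<in>E. 1/2 * (h (J u) e * h (J w) e))"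
      by (intro sum.cong refl)
    then show ?thesis
      by (simp only: sum_distrib_left[symmetric] parseval)
  qed
  finally show ?thesis by simp
qed

text \<open>\<open>ric\<close> is the same for both metrics, but raising an index with
  \<open>ip\<close> instead of \<open>h\<close> costs the factor \<eta>.\<close>

lemma Ric_scaled_eq:
  assumes ip: "is_inner_product ip" and h: "h = (\<lambda>x y. \<eta> * ip x y)" and "\<eta> \<noteq> 0"
  shows "Ric br ip u =
    \<eta> *\<^sub>R ((1/4 * (\<Sum>e\<in>E. h (J e) (J e)) * h u z) *\<^sub>R z + (1/2) *\<^sub>R J (J u))"
proof (rule Ric_eqI[OF ip])
  fix w
  have scale: "ip (\<eta> *\<^sub>R x) w = h x w" for x
    using bilinear_lmul[of ip \<eta> x w] ip by (simp add: h is_inner_product_def)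
  have "ric br ip u w = ric br h u w"
    unfolding h by (simp add: ric_scale[OF \<open>\<eta> \<noteq> 0\<close>])
  then show "ip (\<eta> *\<^sub>R ((1/4 * (\<Sum>e\<in>E. h (J e) (J e)) * h u z) *\<^sub>R z + (1/2) *\<^sub>R J (J u))) w
      = ric br ip u w"
    unfolding scale using skew[of "J u" w]
    by (simp add: ric_eq h_simps sym[of z w])
qed

end

section \<open>The nilsoliton criterion\<close>

theorem corollary1:
  fixes br :: "'a::real_vector \<Rightarrow> 'a \<Rightarrow> 'a"
    and ip :: "'a \<Rightarrow> 'a \<Rightarrow> real"
    and v :: "nat \<Rightarrow> 'a"
    and \<eta> \<alpha> \<beta> \<gamma> :: real
  assumes "is_A54 br"
    and "is_inner_product ip"
    and "\<eta> > 0"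
    and "is_basis5 v"
    and "orthonormal5 (\<lambda>x y. \<eta> * ip x y) v"
    and "has_brackets br v \<alpha> \<beta> \<gamma>"
    and "\<beta> > 0" and "\<gamma> > 0"
  shows "nilsoliton br ip \<longleftrightarrow> \<alpha> = 0 \<and> \<beta> = \<gamma>"
proof -
  define h where "h = (\<lambda>x y. \<eta> * ip x y)"
  have I5: "{1..5::nat} = {1, 2, 3, 4, 5}" by auto
  have bilb: "bilinear br" and alt: "\<And>x. br x x = 0"
    using assms(1) by (auto simp: is_A54_def is_lie_bracket_def)
  have anti: "br x y = - br y x" for x y
    using alt[of "x + y"] alt[of x] alt[of y]
    by (simp add: bilinear_ladd[OF bilb] bilinear_radd[OF bilb] eq_neg_iff_add_eq_0 add.commute)
  have ih: "is_inner_product h"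
    using assms(2,3) unfolding h_def is_inner_product_def bilinear_def
    by (auto intro!: linearI simp: linear_add linear_scale algebra_simps)
  have ov: "i \<in> {1..5} \<Longrightarrow> j \<in> {1..5} \<Longrightarrow> h (v i) (v j) = (if i = j then 1 else 0)" for i j
    using assms(5) by (auto simp: orthonormal5_def h_def)
  interpret orthonormal_frame h "v ` {1..5}"
  proof
    show "h a b = (if a = b then 1 else 0)" if "a \<in> v ` {1..5}" "b \<in> v ` {1..5}" for a b
      using that assms(4) by (auto simp: ov is_basis5_def inj_on_eq_iff)
  qed (use ih assms(4) in \<open>auto simp: is_basis5_def\<close>)
  \<comment> \<open>The \<open>v j\<close>-coefficient of \<open>J (v i)\<close> is the
    \<open>v 5\<close>-coefficient of \<open>br (v i) (v j)\<close>.\<close>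
  define J where "J u = (- \<alpha> * h u (v 3) - \<beta> * h u (v 4)) *\<^sub>R v 1 - (\<gamma> * h u (v 3)) *\<^sub>R v 2
    + (\<alpha> * h u (v 1) + \<gamma> * h u (v 2)) *\<^sub>R v 3 + (\<beta> * h u (v 1)) *\<^sub>R v 4" for u
  have lJ: "linear J"
    by (rule linearI) (simp_all add: J_def h_simps algebra_simps)
  have skewJ: "h (J x) y = - h x (J y)" for x y
    by (simp add: J_def h_simps sym[of "v _" y] algebra_simps)
  have br_less: "br (v i) (v j) = h (J (v i)) (v j) *\<^sub>R v 5"
    if "i \<in> {1..5}" "j \<in> {1..5}" "i < j" for i j
    using that assms(6) unfolding has_brackets_def I5
    by (auto simp: J_def h_simps ov)
  \<comment> \<open>\<open>has_brackets\<close> only lists pairs with \<open>i < j\<close>;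
    antisymmetry of \<open>br\<close> and skewness of \<open>J\<close> supply the others.\<close>
  have br_basis: "br (v i) (v j) = h (J (v i)) (v j) *\<^sub>R v 5"
    if ij: "i \<in> {1..5}" "j \<in> {1..5}" for i j
  proof (cases i j rule: linorder_cases)
    case less
    with ij show ?thesis by (rule br_less)
  next
    case equal
    then show ?thesis
      using skewJ[of "v i" "v i"] sym[of "v i" "J (v i)"] by (simp add: alt)
  next
    case greater
    then show ?thesis
      using br_less[of j i] ij anti[of "v i" "v j"] skewJ[of "v i" "v j"] sym[of "v i" "J (v j)"]
      by simp
  qed
  interpret heisenberg_type h "v ` {1..5}" br J "v 5"
  proof (intro heisenberg_type.intro heisenberg_type_axioms.intro orthonormal_frame_axioms)
    show "linear J" by (rule lJ)
    show "h (J x) y = - h x (J y)" for x y by (rule skewJ)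
    show "J (v 5) = 0" "h (v 5) (v 5) = 1"
      by (simp_all add: J_def ov)
    show "br x y = h (J x) y *\<^sub>R v 5" for x y
    proof (rule bilinear_eq[OF bilb, where g = "\<lambda>x y. h (J x) y *\<^sub>R v 5" and S = UNIV and T = UNIV
          and B = "v ` {1..5}" and C = "v ` {1..5}"])
      show "bilinear (\<lambda>x y. h (J x) y *\<^sub>R v 5)"
        unfolding bilinear_def
        by (auto intro!: linearI simp: h_simps linear_add[OF lJ] linear_scale[OF lJ] scaleR_add_left)
    qed (auto simp: span_E br_basis simp del: One_nat_def)
  qed
  define S where "S = 1/4 * (\<Sum>e\<in>v ` {1..5}. h (J e) (J e))"
  have Ric: "Ric br ip u = \<eta> *\<^sub>R ((S * h u (v 5)) *\<^sub>R v 5 + (1/2) *\<^sub>R J (J u))" for u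
    unfolding S_def using Ric_scaled_eq[OF assms(2) h_def] assms(3) by simp
  show ?thesis
  proof
    assume "nilsoliton br ip"
    then obtain c D where D: "derivation br D" and "\<And>u. Ric br ip u = c *\<^sub>R u + D u"
      by (auto simp: nilsoliton_def)
    then have D_eq: "D u = Ric br ip u - c *\<^sub>R u" for u by simp
    have leib: "h (D (br x y)) (v 5) = h (br (D x) y) (v 5) + h (br x (D y)) (v 5)" for x y
      using D by (simp add: derivation_def h_simps)
    \<comment> \<open>\<open>J (J (v 2))\<close> has \<open>v 1\<close>-component
      \<open>- \<alpha> * \<gamma>\<close> and \<open>J (J (v 4))\<close> has
      \<open>v 3\<close>-component \<open>- \<alpha> * \<beta>\<close>, so both right-hand terms are
      the same multiple of \<open>\<alpha> * \<beta> * \<gamma>\<close>.\<close>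
    have "\<alpha> = 0"
      using leib[of "v 2" "v 4"] assms(3,7,8)
      by (simp add: D_eq Ric br J_def h_simps ov)
    moreover have "\<beta> = \<gamma>"
    proof -
      \<comment> \<open>For \<alpha> = 0 the map \<open>D\<close> is diagonal in the frame, and the
        eigenvalue on \<open>v 5\<close> must be the sum of those on the bracketed vectors.
        \<open>S\<close> and \<open>c\<close> enter both rules alike and drop out.\<close>
      have "\<beta> * (\<eta> * S) = \<beta> * (- \<eta> * \<beta>^2 - c)"
        using leib[of "v 1" "v 4"] \<open>\<alpha> = 0\<close>
        by (simp add: D_eq Ric br J_def h_simps ov power2_eq_square algebra_simps)
      moreover have "\<gamma> * (\<eta> * S) = \<gamma> * (- \<eta> * \<gamma>^2 - c)"
        using leib[of "v 2" "v 3"] \<open>\<alpha> = 0\<close>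
        by (simp add: D_eq Ric br J_def h_simps ov power2_eq_square algebra_simps)
      ultimately have "\<beta>^2 = \<gamma>^2"
        using assms(3,7,8) by simp
      then show ?thesis
        using assms(7,8) by (simp add: power2_eq_iff_nonneg)
    qed
    ultimately show "\<alpha> = 0 \<and> \<beta> = \<gamma>" by simp
  next
    assume eq: "\<alpha> = 0 \<and> \<beta> = \<gamma>"
    from eq have "\<alpha> = 0" and g: "\<gamma> = \<beta>" by simp_all
    \<comment> \<open>Here \<open>J\<close> is \<beta> times an orthogonal complex structure on the
      complement of \<open>v 5\<close>.\<close>
    have JJ: "J (J u) = (- (\<beta>^2)) *\<^sub>R (u - h u (v 5) *\<^sub>R v 5)" for u
    proof (rule linear_eq_on[where f = "\<lambda>u. J (J u)"])
      show "linear (\<lambda>u. J (J u))"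
        using linear_compose[OF lJ lJ] by (simp add: o_def)
      show "linear (\<lambda>u. (- (\<beta>^2)) *\<^sub>R (u - h u (v 5) *\<^sub>R v 5))"
        by (rule linearI) (simp_all add: h_simps algebra_simps)
      show "u \<in> span (v ` {1..5})" by (simp only: span_E UNIV_I)
      show "J (J b) = (- (\<beta>^2)) *\<^sub>R (b - h b (v 5) *\<^sub>R v 5)" if "b \<in> v ` {1..5}" for b
        using that unfolding I5
        by (auto simp: J_def h_simps ov \<open>\<alpha> = 0\<close> g power2_eq_square)
    qed
    have "S = \<beta>^2"
      using assms(4) unfolding S_def is_basis5_def
      unfolding I5 by (simp add: sum.reindex J_def h_simps ov \<open>\<alpha> = 0\<close> g power2_eq_square)
    \<comment> \<open>A multiple of the grading derivation with weight 1 on the complement of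
      \<open>v 5\<close> and weight 2 on \<open>v 5\<close>. The Ricci eigenvalues there are
      \<open>- \<eta> * \<beta>^2 / 2\<close> and \<open>\<eta> * \<beta>^2\<close>; requiring the
      second, shifted by \<open>- c\<close>, to be twice the first gives
      \<open>c = - 2 * \<eta> * \<beta>^2\<close>.\<close>
    define D where "D u = (3/2 * \<eta> * \<beta>^2) *\<^sub>R (u + h u (v 5) *\<^sub>R v 5)" for u
    have "derivation br D"
      unfolding derivation_def
    proof (intro conjI allI)
      show "linear D"
        by (rule linearI) (simp_all add: D_def h_simps algebra_simps)
      show "D (br x y) = br (D x) y + br x (D y)" for x y
        by (simp add: D_def br h_simps J_simps hJz zz flip: scaleR_add_left)
    qed
    moreover have "Ric br ip u = (- 2 * \<eta> * \<beta>^2) *\<^sub>R u + D u" for u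
    proof -
      let ?t = "\<eta> * \<beta>^2" and ?s = "h u (v 5)"
      have "Ric br ip u = (?t * ?s + ?t * ?s / 2) *\<^sub>R v 5 + (- (?t / 2)) *\<^sub>R u"
        unfolding scaleR_add_left
        by (simp add: Ric JJ \<open>S = \<beta>^2\<close> scaleR_diff_right scaleR_add_right mult_ac)
      also have "\<dots> = (3/2 * ?t * ?s) *\<^sub>R v 5 + (- 2 * ?t + 3/2 * ?t) *\<^sub>R u"
        by (intro arg_cong2[where f = "(+)"] arg_cong2[where f = scaleR]) simp_all
      also have "\<dots> = (- 2 * \<eta> * \<beta>^2) *\<^sub>R u + D u"
        unfolding scaleR_add_left D_def by (simp add: scaleR_add_right mult_ac)
      finally show ?thesis .
    qed
    ultimately show "nilsoliton br ip"
      unfolding nilsoliton_def by blast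
  qed
qed

end
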